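(* There is no subsequence of $\{\Gamma_n\}_{n\in\mathbb{N}}$ whose first derivative is uniformly bounded on $[-\pi,\pi]$. Equivalently, $\|F_n'\|_{L^\infty([-\pi,\pi])}\to\infty$ as $n\to\infty$.
   Context: For $n\in\mathbb{N}$ and a prime $p$, $v_p(n!)$ denotes the exponent of $p$ in the prime factorization of $n!$. For each $n\in\mathbb{N}$ define $F_n(t)=\sum_{p\le n} v_p(n!)\,e^{ipt}$ for $t\in[-\pi,\pi]$, where the sum runs over primes $p\le n$. The associated planar curve is $\Gamma_n(t)=(\operatorname{Re}F_n(t),\operatorname{Im}F_n(t))\in\mathbb{R}^2$, $t\in[-\pi,\pi]$, so that $|\Gamma_n'(t)|=|F_n'(t)|$. A subsequence $(\Gamma_{n_k})_k$ (with $n_1<n_2<\cdots$) has uniformly bounded first derivative if there is a constant $M$ with $|\Gamma_{n_k}'(t)|\le M$ for all $k$ and all $t\in[-\pi,\pi]$. *)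

theory Defs
  imports
    "HOL-Analysis.Analysis"
    "HOL-Probability.Essential_Supremum"
    "HOL-Computational_Algebra.Primes"
begin

definition F :: "nat \<Rightarrow> real \<Rightarrow> complex" where
  "F n t = (\<Sum>p | prime p \<and> p \<le> n.
     of_nat (multiplicity p (fact n :: nat)) * exp (\<i> * of_nat p * of_real t))"

definition \<Gamma> :: "nat \<Rightarrow> real \<Rightarrow> real^2" where
  "\<Gamma> n t = vector [Re (F n t), Im (F n t)]"

text \<open>
  The functions \<^term>\<open>F n\<close> and \<^term>\<open>\<Gamma> n\<close> are defined on the whole line, but the paper considers
  them on \<open>[-\<pi>, \<pi>]\<close> only. Derivatives are therefore taken within that interval; this makes them
  one-sided at the end points.
\<close>

definition uniformly_bounded_first_derivative :: "(nat \<Rightarrow> real \<Rightarrow> real^2) \<Rightarrow> bool" where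
  "uniformly_bounded_first_derivative g \<longleftrightarrow>
     (\<exists>M::real. \<forall>k. \<forall>t\<in>{-pi..pi}. norm (vector_derivative (g k) (at t within {-pi..pi})) \<le> M)"

text \<open>
  The library sets \<^const>\<open>esssup\<close> to \<open>\<infinity>\<close> for non-measurable functions. Below, the norm is only
  applied to derivatives of trigonometric polynomials, which are continuous.
\<close>

definition Linf_norm :: "real set \<Rightarrow> (real \<Rightarrow> complex) \<Rightarrow> ereal" where
  "Linf_norm S f = esssup (lebesgue_on S) (\<lambda>t. ereal (norm (f t)))"

end

theory Submission imports Defs begin

text \<open>
  At \<open>t = 0\<close> all the terms of \<open>F\<^sub>n'\<close> point in the direction \<open>\<i>\<close>, so \<open>|F\<^sub>n'(0)| = \<Sum> p v\<^sub>p(n!)\<close>. The term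
  \<open>p = 2\<close> alone is at least \<open>n - 1\<close>, and since \<open>F\<^sub>n'\<close> is continuous, its essential supremum is at
  least its value at \<open>0\<close>.
\<close>

text \<open>Passing from 2k to 2k + 2 multiplies the factorial by (2k + 1)(2k + 2), which brings in
  at least one more factor 2.\<close>

lemma power_two_dvd_fact_double: "2 ^ k dvd (fact (2 * k) :: nat)"
proof (induction k)
  case (Suc k)
  have "(fact (2 * Suc k) :: nat) = 2 * (fact (2 * k)) * ((k + 1) * (2 * k + 1))"
    by (simp add: algebra_simps)
  with Suc show ?case
    by (metis dvd_triv_left dvd_mult2 mult_dvd_mono dvd_refl power_Suc)
qed simp

lemma half_le_multiplicity_two_fact: "n div 2 \<le> multiplicity 2 (fact n :: nat)"
proof -
  have "2 ^ (n div 2) dvd (fact (2 * (n div 2)) :: nat)"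
    by (rule power_two_dvd_fact_double)
  also have "\<dots> dvd fact n"
    by (rule fact_dvd) simp
  finally show ?thesis
    by (intro multiplicity_geI) auto
qed

text \<open>If \<open>f x\<close> exceeded the essential supremum, then by continuity so would
  \<open>f\<close> on an open neighbourhood of \<open>x\<close>, and a nonempty open set is not
  null. Working in the open interval makes this neighbourhood open in the whole line.\<close>

lemma esssup_lebesgue_on_ge:
  fixes f :: "real \<Rightarrow> ereal"
  assumes cont: "continuous_on {a<..<b} f" and x: "a < x" "x < b"
  shows "f x \<le> esssup (lebesgue_on {a..b}) f"
proof (rule ccontr)
  assume "\<not> ?thesis"
  then have less: "esssup (lebesgue_on {a..b}) f < f x" by simp
  define U where "U = {a<..<b} \<inter> f -` {esssup (lebesgue_on {a..b}) f<..}"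
  have "open U"
    unfolding U_def by (rule continuous_open_preimage[OF cont]) auto
  moreover have "x \<in> U"
    using less x by (simp add: U_def)
  ultimately have "\<not> negligible U"
    using open_not_negligible by blast
  moreover have "AE y in lebesgue_on {a..b}. f y \<le> esssup (lebesgue_on {a..b}) f"
    by (rule esssup_AE)
  then have "AE y in lebesgue. y \<in> {a..b} \<longrightarrow> f y \<le> esssup (lebesgue_on {a..b}) f"
    by (subst (asm) AE_restrict_space_iff) auto
  then have "AE y in lebesgue. y \<notin> U"
    by eventually_elim (auto simp: U_def)
  then have "negligible U"
    using \<open>open U\<close> by (simp add: negligible_iff_null_sets AE_iff_null_sets)
  ultimately show False by contradiction
qed

text \<open>The termwise derivative of \<open>F n\<close>, in a closed form that can be evaluated at
  0 and is visibly continuous.\<close>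

definition F' :: "nat \<Rightarrow> real \<Rightarrow> complex" where
  "F' n t = (\<Sum>p | prime p \<and> p \<le> n.
     of_nat (multiplicity p (fact n :: nat)) * (\<i> * of_nat p * exp (\<i> * of_nat p * of_real t)))"

lemma F_has_vector_derivative: "(F n has_vector_derivative F' n t) (at t within S)"
proof -
  have "((\<lambda>t. exp (\<i> * of_nat p * of_real t)) has_vector_derivative
      \<i> * of_nat p * exp (\<i> * of_nat p * of_real t)) (at t within S)" for p :: nat
    by (rule has_vector_derivative_real_field) (auto intro!: derivative_eq_intros)
  then show ?thesis
    unfolding F_def F'_def
    by (intro has_vector_derivative_sum has_vector_derivative_mult_right) auto
qed

lemma vector_derivative_F:
  assumes "t \<in> {-pi..pi}"
  shows "vector_derivative (F n) (at t within {-pi..pi}) = F' n t"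
  using assms by (intro vector_derivative_within_closed_interval F_has_vector_derivative) auto

lemma vector_derivative_\<Gamma>:
  assumes "t \<in> {-pi..pi}"
  shows "vector_derivative (\<Gamma> n) (at t within {-pi..pi}) = vector [Re (F' n t), Im (F' n t)]"
proof (rule vector_derivative_within_closed_interval)
  \<comment> \<open>Expanding in the standard basis exhibits \<open>\<Gamma> n\<close> as a sum of
    bounded linear images of \<open>F n\<close>, so its derivative follows from that of
    \<open>F n\<close>.\<close>
  have \<Gamma>_eq: "\<Gamma> n = (\<lambda>t. Re (F n t) *\<^sub>R axis 1 1 + Im (F n t) *\<^sub>R axis 2 1)"
    by (auto simp: fun_eq_iff \<Gamma>_def vec_eq_iff forall_2 axis_def)
  have "vector [Re (F' n t), Im (F' n t)]
      = Re (F' n t) *\<^sub>R axis 1 1 + Im (F' n t) *\<^sub>R (axis 2 1 :: real ^ 2)"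
    by (auto simp: vec_eq_iff forall_2 axis_def)
  moreover have "(\<Gamma> n has_vector_derivative
      Re (F' n t) *\<^sub>R axis 1 1 + Im (F' n t) *\<^sub>R axis 2 1) (at t within {-pi..pi})"
    unfolding \<Gamma>_eq
    by (intro has_vector_derivative_add
        bounded_linear.has_vector_derivative[OF bounded_linear_scaleR_left]
        bounded_linear.has_vector_derivative[OF bounded_linear_Re]
        bounded_linear.has_vector_derivative[OF bounded_linear_Im] F_has_vector_derivative)
  ultimately show "(\<Gamma> n has_vector_derivative vector [Re (F' n t), Im (F' n t)])
      (at t within {-pi..pi})"
    by simp
qed (use assms in auto)

text \<open>The imaginary part lies below both the complex modulus and the Euclidean norm in the
  plane, so this one estimate serves both claims of the theorem.\<close>

lemma Im_F'_0_ge: "real n - 1 \<le> Im (F' n 0)"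
proof (cases "2 \<le> n")
  case True
  \<comment> \<open>The loss of 1 occurs for odd \<open>n\<close>, where
    \<open>2 * (n div 2) = n - 1\<close>.\<close>
  have "real n - 1 \<le> real (multiplicity 2 (fact n :: nat)) * real 2"
    using half_le_multiplicity_two_fact[of n] by linarith
  also have "\<dots> \<le> (\<Sum>p | prime p \<and> p \<le> n. real (multiplicity p (fact n :: nat)) * real p)"
    using True by (intro member_le_sum) auto
  also have "\<dots> = Im (F' n 0)"
    by (simp add: F'_def)
  finally show ?thesis .
next
  \<comment> \<open>Here the sum is empty and \<open>real n - 1\<close> is at most 0.\<close>
  case False
  have "0 \<le> Im (F' n 0)"
    by (simp add: F'_def sum_nonneg)
  with False show ?thesis by simp
qed

lemma Linf_norm_F_ge:
  "ereal (real n - 1)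
    \<le> Linf_norm {-pi..pi} (\<lambda>t. vector_derivative (F n) (at t within {-pi..pi}))"
proof -
  let ?D = "\<lambda>t. vector_derivative (F n) (at t within {-pi..pi})"
  have "continuous_on {-pi<..<pi} (\<lambda>t. ereal (norm (F' n t)))"
    unfolding F'_def by (intro continuous_intros)
  \<comment> \<open>The two functions agree on the interval, so continuity carries over from
    \<open>F'\<close>.\<close>
  then have cont: "continuous_on {-pi<..<pi} (\<lambda>t. ereal (norm (?D t)))"
    by (simp add: vector_derivative_F cong: continuous_on_cong_simp)
  have "real n - 1 \<le> norm (F' n 0)"
    using Im_F'_0_ge[of n] abs_Im_le_cmod[of "F' n 0"] by linarith
  then have "ereal (real n - 1) \<le> ereal (norm (?D 0))"
    by (simp add: vector_derivative_F)
  also have "\<dots> \<le> Linf_norm {-pi..pi} ?D"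
    unfolding Linf_norm_def by (rule esssup_lebesgue_on_ge[OF cont]) auto
  finally show ?thesis .
qed

theorem theorem5p1:
  shows "\<not> (\<exists>r :: nat \<Rightarrow> nat. strict_mono r \<and>
           uniformly_bounded_first_derivative (\<lambda>k. \<Gamma> (r k)))
       \<and> (\<lambda>n. Linf_norm {-pi..pi} (\<lambda>t. vector_derivative (F n) (at t within {-pi..pi})))
           \<longlonglongrightarrow> \<infinity>"
proof (intro conjI notI)
  assume "\<exists>r :: nat \<Rightarrow> nat. strict_mono r \<and> uniformly_bounded_first_derivative (\<lambda>k. \<Gamma> (r k))"
  then obtain r :: "nat \<Rightarrow> nat" and M where r: "strict_mono r" and
    M: "\<And>k t. t \<in> {-pi..pi} \<Longrightarrow>
      norm (vector_derivative (\<Gamma> (r k)) (at t within {-pi..pi})) \<le> M"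
    unfolding uniformly_bounded_first_derivative_def by blast
  \<comment> \<open>As \<open>r\<close> is strictly increasing, \<open>k \<le> r k\<close>, so a
    uniform bound on the derivatives at 0 would bound all natural numbers.\<close>
  have "real k \<le> M + 1" for k
  proof -
    have "real k \<le> real (r k)"
      using seq_suble[OF r] by simp
    also have "\<dots> \<le> Im (F' (r k) 0) + 1"
      using Im_F'_0_ge[of "r k"] by simp
    also have "Im (F' (r k) 0) \<le> norm (vector [Re (F' (r k) 0), Im (F' (r k) 0)] :: real ^ 2)"
      using component_le_norm_cart[of "vector [Re (F' (r k) 0), Im (F' (r k) 0)] :: real ^ 2" 2]
      by simp
    also have "\<dots> \<le> M"
      using M[of 0 k] by (simp add: vector_derivative_\<Gamma>)
    finally show ?thesis by simp
  qed
  then show False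
    using reals_Archimedean2[of "M + 1"] by (meson not_le)
next
  show "(\<lambda>n. Linf_norm {-pi..pi} (\<lambda>t. vector_derivative (F n) (at t within {-pi..pi})))
      \<longlonglongrightarrow> \<infinity>"
  proof (subst tendsto_PInfty, intro allI)
    fix c :: real
    \<comment> \<open>The extra 1 compensates for the lower bound \<open>real n - 1\<close>.\<close>
    obtain N :: nat where N: "c + 1 < real N"
      using reals_Archimedean2 by blast
    show "\<forall>\<^sub>F n in sequentially.
        ereal c < Linf_norm {-pi..pi} (\<lambda>t. vector_derivative (F n) (at t within {-pi..pi}))"
      using eventually_ge_at_top[of N]
    proof eventually_elim
      case (elim n)
      with N have "ereal c < ereal (real n - 1)" by simp
      then show ?case using Linf_norm_F_ge by (rule less_le_trans)
    qed
  qed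
qed

end
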